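(* Let $S$ be a finite set with $|S|=n$. Then: (1) $\min_{f}|\mathcal{C}(f)|=n$, the minimum being over all functions $f:S\to S$; (2) for $f:S\to S$, $|\mathcal{C}(f)|=n$ if and only if $\Gamma(f)\simeq U_{m,n-m}$ with $1\le m\le n$, or $\Gamma(f)\simeq Z_1\cup U_{m,n-1-m}$ with $1\le m\le n-1$.
   Context: $\mathcal{C}(f)=\{g:S\to S\mid fg=gf\}$. The functional graph $\Gamma(f)$ has vertex set $S$ and edges $[s,f(s)]$, $s\in S$. $Z_1$ is a single vertex with a loop, and $\cup$ is disjoint union of graphs. $U_{m,t}$ is the weakly connected functional graph on $m+t$ vertices consisting of a directed cycle of length $m$ together with a directed path of $t$ vertices outside the cycle, the path leading into one vertex of the cycle (so $U_{m,0}$ is the directed cycle on $m$ vertices).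
   Formalization: In (2), the family Z_1 ∪ U_{m,n-1-m} is taken for 2 ≤ m ≤ n-1 instead of 1 ≤ m ≤ n-1, because for m = 1 there are two fixed points and |C(f)| = 2n (e.g. the identity on two points has |C(f)| = 4). S is assumed nonempty. *)

theory Defs
  imports
    "HOL-Library.FuncSet"
    "Graph_Theory.Pair_Digraph"
    "Graph_Theory.Digraph_Isomorphism"
begin

(* A self-map of S is an element of S \<rightarrow>\<^sub>E S: its values outside S are fixed,
   so that there are exactly card S ^ card S of them and cardinalities are the expected ones. *)

definition centralizer :: "'a set \<Rightarrow> ('a \<Rightarrow> 'a) \<Rightarrow> ('a \<Rightarrow> 'a) set" where
  "centralizer S f = {g \<in> S \<rightarrow>\<^sub>E S. compose S f g = compose S g f}"

definition functional_graph :: "'a set \<Rightarrow> ('a \<Rightarrow> 'a) \<Rightarrow> 'a pair_pre_digraph" where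
  "functional_graph S f = \<lparr> pverts = S, parcs = {(s, f s) | s. s \<in> S} \<rparr>"

definition Z1 :: "unit pair_pre_digraph" where
  "Z1 = \<lparr> pverts = {()}, parcs = {((), ())} \<rparr>"

(* The cycle is 0 \<rightarrow> 1 \<rightarrow> \<dots> \<rightarrow> m - 1 \<rightarrow> 0, the path is m + t - 1 \<rightarrow> \<dots> \<rightarrow> m + 1 \<rightarrow> m,
   and its last vertex m leads to the cycle vertex 0. Meaningful for m \<ge> 1 only. *)
definition U :: "nat \<Rightarrow> nat \<Rightarrow> nat pair_pre_digraph" where
  "U m t = functional_graph {..<m + t}
     (\<lambda>i. if i < m then Suc i mod m else if i = m then 0 else i - 1)"

definition disjoint_union ::
    "'a pair_pre_digraph \<Rightarrow> 'b pair_pre_digraph \<Rightarrow> ('a + 'b) pair_pre_digraph" where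
  "disjoint_union G H =
     \<lparr> pverts = pverts G <+> pverts H,
       parcs = map_prod Inl Inl ` parcs G \<union> map_prod Inr Inr ` parcs H \<rparr>"

definition isomorphic :: "'a pair_pre_digraph \<Rightarrow> 'b pair_pre_digraph \<Rightarrow> bool" where
  "isomorphic G H \<longleftrightarrow> digraph_iso (with_proj G) (with_proj H)"

(* Pitfall: if f has graph Z1 \<union> U 1 t, it has two fixed points and its centralizer has
   2 * (t + 2) elements, twice the number of vertices. Graphs Z1 \<union> U m t have a centralizer
   as small as the vertex set only for m \<ge> 2. *)

end

theory Submission
  imports Defs
begin

text \<open>
  The elements of \<open>\<C>(f)\<close> are the endomorphisms of \<open>S\<close> with the unary operation \<open>f\<close>. Two
  mechanisms force at least \<open>|S|\<close> of them.

  If the graph of \<open>f\<close> is connected, choose a point \<open>v\<close> that needs the largest number of steps to reach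
  the cycle. Every relation between iterates of \<open>v\<close> holds at all points, so each \<open>w\<close> gives a
  homomorphism from the orbit of \<open>v\<close> to \<open>S\<close> that sends \<open>v\<close> to \<open>w\<close>
  (\<open>max_preperiod_relations\<close>). The same choice makes the orbit of \<open>v\<close> a retract of \<open>S\<close>
  (\<open>retraction_onto_orbit\<close>). Composing the two, evaluation at \<open>v\<close> maps \<open>\<C>(f)\<close> onto \<open>S\<close>. When
  \<open>|\<C>(f)| = |S|\<close>, evaluation is injective too; the retraction and the identity agree at \<open>v\<close>, so they
  are equal and \<open>S\<close> is the orbit of \<open>v\<close>, a cycle with one tail.

  If \<open>S\<close> splits into invariant parts \<open>A\<close> and \<open>B\<close>, maps from \<open>A\<close> to \<open>S\<close> and from \<open>B\<close> to \<open>S\<close> can be chosen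
  independently, so the numbers multiply. By induction they are at least \<open>|A|\<close> and \<open>|B|\<close>, and the
  product exceeds the sum when both parts have two or more points
  (\<open>card_equivariant_large_parts\<close>). If one part is a fixed point, the constant map onto it adds one
  to the endomorphisms of the other part. Equality then requires that the other part contain no
  fixed point and again attain the minimum (\<open>card_equivariant_isolated_fixed_point\<close>), so by induction
  it is an orbit, whose cycle has length at least two.

  Conversely, in both extremal cases an endomorphism is determined by its value at the generator of
  the orbit (\<open>card_equivariant_le\<close>). Finally, an orbit is determined up to isomorphism by its size and
  the place where it returns to itself (\<open>conjugate_if_same_return\<close>), which identifies these cases
  with the graphs \<open>U\<close> and \<open>Z1 \<union> U\<close>.
\<close>


section \<open>Equivariant maps and forward orbits\<close>

text \<open>
  Source and target may differ, because the parts of a decomposition are to be mapped into each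
  other and into the whole. For \<open>A = B = S\<close> this is the centralizer.
\<close>

definition equivariant :: "('a \<Rightarrow> 'a) \<Rightarrow> 'a set \<Rightarrow> 'a set \<Rightarrow> ('a \<Rightarrow> 'a) set" where
  "equivariant f A B = {g \<in> A \<rightarrow>\<^sub>E B. \<forall>x\<in>A. g (f x) = f (g x)}"

definition forward_orbit :: "('a \<Rightarrow> 'a) \<Rightarrow> 'a \<Rightarrow> 'a set" where
  "forward_orbit f v = range (\<lambda>i. (f ^^ i) v)"

lemma centralizer_eq_equivariant:
  assumes "f \<in> S \<rightarrow> S"
  shows "centralizer S f = equivariant f S S"
  unfolding centralizer_def equivariant_def compose_def
  by (auto simp: fun_eq_iff)

lemma finite_equivariant:
  assumes "finite A" "finite B"
  shows "finite (equivariant f A B)"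
  unfolding equivariant_def using finite_PiE[of A "\<lambda>_. B"] assms by simp

lemma equivariant_mono: "B \<subseteq> C \<Longrightarrow> equivariant f A B \<subseteq> equivariant f A C"
  unfolding equivariant_def by (auto simp: PiE_def)

lemma restrict_in_equivariant:
  assumes "f \<in> A \<rightarrow> A" "\<And>x. x \<in> A \<Longrightarrow> g x \<in> B" "\<And>x. x \<in> A \<Longrightarrow> g (f x) = f (g x)"
  shows "restrict g A \<in> equivariant f A B"
  using assms unfolding equivariant_def by (auto simp: Pi_iff)

lemma const_in_equivariant:
  assumes "f \<in> A \<rightarrow> A" "p \<in> B" "f p = p"
  shows "(\<lambda>_\<in>A. p) \<in> equivariant f A B"
  using assms by (intro restrict_in_equivariant) auto

lemma funpow_closed:
  assumes "f \<in> S \<rightarrow> S" "x \<in> S"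
  shows "(f ^^ i) x \<in> S"
  using assms by (induction i) auto

lemma equivariant_funpow:
  assumes "g \<in> equivariant f A B" "f \<in> A \<rightarrow> A" "x \<in> A"
  shows "g ((f ^^ i) x) = (f ^^ i) (g x)"
  using assms by (induction i) (auto simp: equivariant_def funpow_closed)

lemma forward_orbit_subset:
  assumes "f \<in> S \<rightarrow> S" "v \<in> S"
  shows "forward_orbit f v \<subseteq> S"
  using funpow_closed[OF assms] by (auto simp: forward_orbit_def)

lemma self_in_forward_orbit: "v \<in> forward_orbit f v"
  unfolding forward_orbit_def by (rule range_eqI[of _ _ 0]) simp

lemma forward_orbit_closed: "f \<in> forward_orbit f v \<rightarrow> forward_orbit f v"
proof
  fix x assume "x \<in> forward_orbit f v"
  then obtain i where "x = (f ^^ i) v" by (auto simp: forward_orbit_def)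
  then have "f x = (f ^^ Suc i) v" by simp
  then show "f x \<in> forward_orbit f v" unfolding forward_orbit_def by (rule range_eqI)
qed

text \<open>
  The value of an equivariant map at \<open>v\<close> determines it on the orbit of \<open>v\<close>, and a fixed point
  without rival can only be sent to itself.
\<close>

lemma card_equivariant_le:
  assumes "finite S" "f \<in> S \<rightarrow> S" "v \<in> S"
    and rest: "\<And>x y. x \<in> S - forward_orbit f v \<Longrightarrow> y \<in> S \<Longrightarrow> f y = y \<longleftrightarrow> y = x"
  shows "card (equivariant f S S) \<le> card S"
proof (rule card_inj_on_le[where f = "\<lambda>g. g v"])
  show "inj_on (\<lambda>g. g v) (equivariant f S S)"
  proof
    fix g h assume g: "g \<in> equivariant f S S" and h: "h \<in> equivariant f S S" and eq: "g v = h v"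
    have fixed: "k x = x" if k: "k \<in> equivariant f S S" and x: "x \<in> S - forward_orbit f v" for k x
    proof -
      have "f x = x" using rest[OF x, of x] x by auto
      then have "f (k x) = k x" using k x by (auto simp: equivariant_def)
      then show ?thesis using rest[OF x, of "k x"] k x by (auto simp: equivariant_def)
    qed
    have "g x = h x" if "x \<in> S" for x
    proof (cases "x \<in> forward_orbit f v")
      case True
      then obtain i where "x = (f ^^ i) v" by (auto simp: forward_orbit_def)
      then show ?thesis
        using equivariant_funpow[OF g] equivariant_funpow[OF h] assms eq by simp
    next
      case False
      then show ?thesis using fixed[OF g] fixed[OF h] that by simp
    qed
    then show "g = h" using g h unfolding equivariant_def by (auto intro: PiE_ext)
  qed
qed (use assms in \<open>auto simp: equivariant_def\<close>)


section \<open>Indecomposable maps\<close>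

text \<open>
  Weak connectedness of the functional graph, phrased as the absence of a splitting into two
  parts that the map preserves.
\<close>

definition indecomposable :: "('a \<Rightarrow> 'a) \<Rightarrow> 'a set \<Rightarrow> bool" where
  "indecomposable f S \<longleftrightarrow>
     (\<forall>A. A \<subseteq> S \<longrightarrow> A \<noteq> {} \<longrightarrow> A \<noteq> S \<longrightarrow> f \<in> A \<rightarrow> A \<longrightarrow> \<not> f \<in> (S - A) \<rightarrow> (S - A))"

definition periodic :: "('a \<Rightarrow> 'a) \<Rightarrow> 'a \<Rightarrow> bool" where
  "periodic f x \<longleftrightarrow> (\<exists>p>0. (f ^^ p) x = x)"

definition preperiod :: "('a \<Rightarrow> 'a) \<Rightarrow> 'a \<Rightarrow> nat" where
  "preperiod f x = (LEAST i. periodic f ((f ^^ i) x))"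

lemma indecomposable_orbits_meet:
  assumes "indecomposable f S" "f \<in> S \<rightarrow> S" "x \<in> S" "y \<in> S"
  shows "\<exists>i j. (f ^^ i) x = (f ^^ j) y"
proof -
  define A where "A = {z \<in> S. \<exists>i j. (f ^^ i) x = (f ^^ j) z}"
  have "x \<in> A" using assms(3) unfolding A_def by blast
  have "f \<in> A \<rightarrow> A"
  proof
    fix z assume z: "z \<in> A"
    then obtain i j where "(f ^^ i) x = (f ^^ j) z" by (auto simp: A_def)
    then have "(f ^^ Suc i) x = (f ^^ j) (f z)" by (simp add: funpow_swap1)
    then show "f z \<in> A" using z assms(2) unfolding A_def by blast
  qed
  moreover have "f \<in> (S - A) \<rightarrow> (S - A)"
  proof
    fix z assume z: "z \<in> S - A"
    have "f z \<notin> A"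
    proof
      assume "f z \<in> A"
      then obtain i j where "(f ^^ i) x = (f ^^ j) (f z)" by (auto simp: A_def)
      then have "(f ^^ i) x = (f ^^ Suc j) z" by (simp add: funpow_swap1)
      then show False using z unfolding A_def by blast
    qed
    then show "f z \<in> S - A" using z assms(2) by auto
  qed
  moreover have "A \<subseteq> S" by (auto simp: A_def)
  ultimately have "A = S"
    using assms(1) \<open>x \<in> A\<close> unfolding indecomposable_def by blast
  then show ?thesis using assms(4) unfolding A_def by blast
qed

lemma funpow_funpow: "(f ^^ i) ((f ^^ j) x) = (f ^^ (i + j)) x"
  by (simp add: funpow_add)

lemma funpow_period_mult:
  assumes "(f ^^ p) x = x"
  shows "(f ^^ (p * k)) x = x"
  using assms by (induction k) (auto simp: funpow_add)

lemma periodic_funpow: "periodic f x \<Longrightarrow> periodic f ((f ^^ i) x)"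
  unfolding periodic_def by (metis add.commute funpow_funpow)

lemma funpow_repeat:
  assumes "(f ^^ i) x = (f ^^ j) x" "i < j"
  shows "(f ^^ (j - i)) ((f ^^ i) x) = (f ^^ i) x"
  using assms by (metis funpow_funpow le_add_diff_inverse2 less_imp_le)

lemma eventually_periodic:
  assumes "finite S" "f \<in> S \<rightarrow> S" "x \<in> S"
  shows "\<exists>i. periodic f ((f ^^ i) x)"
proof -
  have "finite (range (\<lambda>i. (f ^^ i) x))"
    using forward_orbit_subset[OF assms(2,3)] assms(1)
    by (auto simp: forward_orbit_def intro: finite_subset)
  then have "\<not> inj (\<lambda>i. (f ^^ i) x)" by (auto dest: finite_imageD)
  then obtain i j where "i \<noteq> j" "(f ^^ i) x = (f ^^ j) x" by (auto simp: inj_def)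
  then obtain i j where ij: "i < j" "(f ^^ i) x = (f ^^ j) x"
    by (metis nat_neq_iff)
  then have "(f ^^ (j - i)) ((f ^^ i) x) = (f ^^ i) x" "0 < j - i"
    using funpow_repeat[OF ij(2,1)] ij(1) by simp_all
  then show ?thesis unfolding periodic_def by blast
qed

lemma periodic_iff_preperiod_le:
  assumes "finite S" "f \<in> S \<rightarrow> S" "x \<in> S"
  shows "periodic f ((f ^^ i) x) \<longleftrightarrow> preperiod f x \<le> i"
proof
  show "periodic f ((f ^^ i) x) \<Longrightarrow> preperiod f x \<le> i"
    unfolding preperiod_def by (rule Least_le)
next
  assume le: "preperiod f x \<le> i"
  have "periodic f ((f ^^ preperiod f x) x)"
    unfolding preperiod_def using eventually_periodic[OF assms] by (rule LeastI_ex)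
  then have "periodic f ((f ^^ (i - preperiod f x)) ((f ^^ preperiod f x) x))"
    by (rule periodic_funpow)
  then show "periodic f ((f ^^ i) x)"
    using le by (simp add: funpow_funpow)
qed

text \<open>
  An indecomposable map has a single cycle, so that any period of one point on it is a period of
  all of them.
\<close>

lemma indecomposable_common_period:
  assumes "indecomposable f S" "f \<in> S \<rightarrow> S" "x \<in> S" "y \<in> S"
    and "(f ^^ p) x = x" "periodic f y"
  shows "(f ^^ p) y = y"
proof -
  obtain i j where ij: "(f ^^ i) x = (f ^^ j) y"
    using indecomposable_orbits_meet[OF assms(1-4)] by blast
  obtain q where q: "q > 0" "(f ^^ q) y = y" using assms(6) by (auto simp: periodic_def)
  \<comment> \<open>going round the cycle often enough leads from the meeting point back to \<open>y\<close>\<close>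
  have "q * j \<ge> j" using q by simp
  then have "(f ^^ (q * j)) y = (f ^^ (q * j - j)) ((f ^^ j) y)"
    by (simp add: funpow_funpow)
  then have y: "y = (f ^^ (q * j - j + i)) x"
    using funpow_period_mult[OF q(2)] unfolding ij[symmetric] by (simp add: funpow_funpow)
  have "(f ^^ p) ((f ^^ (q * j - j + i)) x) = (f ^^ (q * j - j + i)) ((f ^^ p) x)"
    by (simp only: funpow_funpow add.commute)
  then show ?thesis using assms(5) unfolding y by simp
qed

text \<open>
  A point \<open>v\<close> of largest preperiod is as free as possible: every coincidence between its iterates
  holds at all points. So any value can be prescribed at \<open>v\<close> for a map on the orbit of \<open>v\<close>.
\<close>

lemma max_preperiod_relations:
  assumes S: "finite S" "f \<in> S \<rightarrow> S" and ind: "indecomposable f S"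
    and v: "v \<in> S" and w: "w \<in> S" and max: "preperiod f w \<le> preperiod f v"
    and eq: "(f ^^ i) v = (f ^^ j) v"
  shows "(f ^^ i) w = (f ^^ j) w"
proof -
  have *: "(f ^^ i) w = (f ^^ j) w" if eq: "(f ^^ i) v = (f ^^ j) v" and lt: "i < j" for i j
  proof -
    have per: "(f ^^ (j - i)) ((f ^^ i) v) = (f ^^ i) v" by (rule funpow_repeat[OF eq lt])
    then have "periodic f ((f ^^ i) v)" using lt unfolding periodic_def by (auto intro: exI[of _ "j - i"])
    then have "preperiod f v \<le> i" using periodic_iff_preperiod_le[OF S v] by simp
    then have "periodic f ((f ^^ i) w)" using periodic_iff_preperiod_le[OF S w] max by simp
    then have "(f ^^ (j - i)) ((f ^^ i) w) = (f ^^ i) w"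
      using indecomposable_common_period[OF ind S(2) _ _ per] funpow_closed[OF S(2)] v w by blast
    then show ?thesis using lt by (simp add: funpow_funpow)
  qed
  show ?thesis
  proof (cases i j rule: linorder_cases)
    case less
    then show ?thesis by (rule *[OF eq])
  next
    case equal
    then show ?thesis by simp
  next
    case greater
    then show ?thesis by (rule *[OF eq[symmetric], symmetric])
  qed
qed

text \<open>
  A point of largest preperiod generates a retract. An equivariant map into the orbit of \<open>v\<close>
  extends to a further point \<open>u\<close> as soon as the prescribed image of \<open>f u\<close> has a preimage under
  \<open>f\<close> in that orbit. Only \<open>v\<close> itself can fail to have one, and only if \<open>v\<close> is not periodic. Then
  \<open>f u\<close> has a smaller preperiod than \<open>v\<close>, so its image cannot be \<open>v\<close>.
\<close>

lemma retraction_onto_orbit: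
  assumes S: "finite S" "f \<in> S \<rightarrow> S" and ind: "indecomposable f S"
    and v: "v \<in> S" and max: "\<And>w. w \<in> S \<Longrightarrow> preperiod f w \<le> preperiod f v"
  shows "\<exists>r \<in> equivariant f S (forward_orbit f v). \<forall>x \<in> forward_orbit f v. r x = x"
proof -
  let ?O = "forward_orbit f v"
  define P where "P T \<longleftrightarrow> ?O \<subseteq> T \<and> T \<subseteq> S \<and> f \<in> T \<rightarrow> T \<and>
    (\<exists>r \<in> equivariant f T ?O. \<forall>x \<in> ?O. r x = x)" for T
  have OS: "?O \<subseteq> S" by (rule forward_orbit_subset[OF S(2) v])
  have "restrict (\<lambda>x. x) ?O \<in> equivariant f ?O ?O"
    by (intro restrict_in_equivariant forward_orbit_closed) auto
  then have "P ?O"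
    unfolding P_def using OS forward_orbit_closed[of f v]
    by (intro conjI bexI[of _ "restrict (\<lambda>x. x) ?O"]) auto
  moreover have "card T < Suc (card S)" if "P T" for T
    using that S(1) unfolding P_def by (simp add: card_mono less_Suc_eq_le)
  ultimately obtain T where T: "P T" and Tmax: "\<And>T'. P T' \<Longrightarrow> card T' \<le> card T"
    using ex_has_greatest_nat[of P ?O card "Suc (card S)"] by metis
  have TS: "?O \<subseteq> T" "T \<subseteq> S" "f \<in> T \<rightarrow> T" using T by (auto simp: P_def)
  obtain r where r: "r \<in> equivariant f T ?O" "\<And>x. x \<in> ?O \<Longrightarrow> r x = x"
    using T unfolding P_def by blast
  have "T = S"
  proof (rule ccontr)
    assume "T \<noteq> S"
    then obtain u0 where u0: "u0 \<in> S" "u0 \<notin> T" using TS by blast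
    have "\<exists>i. (f ^^ i) u0 \<in> T"
    proof -
      obtain i j where "(f ^^ i) u0 = (f ^^ j) v"
        using indecomposable_orbits_meet[OF ind S(2) u0(1) v] by blast
      then have "(f ^^ i) u0 \<in> ?O" by (auto simp: forward_orbit_def)
      then show ?thesis using TS by blast
    qed
    then obtain i where i: "(f ^^ i) u0 \<in> T" and imin: "\<And>j. j < i \<Longrightarrow> (f ^^ j) u0 \<notin> T"
      using exists_least_iff[of "\<lambda>i. (f ^^ i) u0 \<in> T"] by blast
    from i u0(2) obtain k where k: "i = Suc k" by (cases i) auto
    \<comment> \<open>the last point outside \<open>T\<close> on the way from \<open>u0\<close> into \<open>T\<close>\<close>
    define u where "u = (f ^^ k) u0"
    have u: "u \<in> S" "u \<notin> T" "f u \<in> T"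
      using i imin[of k] funpow_closed[OF S(2) u0(1)] by (simp_all add: u_def k)
    have "\<exists>y \<in> ?O. f y = r (f u)"
    proof -
      have "r (f u) \<in> ?O" using r(1) u(3) by (auto simp: equivariant_def)
      then obtain l where l: "r (f u) = (f ^^ l) v" by (auto simp: forward_orbit_def)
      have step: "\<exists>y \<in> ?O. f y = (f ^^ Suc l) v" for l
        unfolding forward_orbit_def by auto
      show ?thesis
      proof (cases l)
        case (Suc l')
        then show ?thesis using step[of l'] l by simp
      next
        case 0
        then have rv: "r (f u) = v" using l by simp
        have "periodic f v"
        proof (rule ccontr)
          assume "\<not> periodic f v"
          then have "preperiod f v \<noteq> 0"
            using periodic_iff_preperiod_le[OF S v, of 0] by simp
          then obtain t where t: "preperiod f v = Suc t" by (cases "preperiod f v") auto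
          have "periodic f ((f ^^ Suc t) u)"
            using periodic_iff_preperiod_le[OF S u(1)] max[OF u(1)] t by (simp del: funpow.simps)
          then obtain p where p: "p > 0" "(f ^^ p) ((f ^^ t) (f u)) = (f ^^ t) (f u)"
            by (auto simp: periodic_def funpow_swap1)
          have "(f ^^ p) ((f ^^ t) v) = r ((f ^^ p) ((f ^^ t) (f u)))"
            using equivariant_funpow[OF r(1) TS(3)] funpow_closed[OF TS(3)] u(3) rv by simp
          also have "\<dots> = (f ^^ t) v"
            using equivariant_funpow[OF r(1) TS(3)] u(3) rv p by simp
          finally have "periodic f ((f ^^ t) v)" using p(1) by (auto simp: periodic_def)
          then show False using periodic_iff_preperiod_le[OF S v] t by simp
        qed
        then obtain p where "p > 0" "(f ^^ p) v = v" by (auto simp: periodic_def)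
        then show ?thesis using step[of "p - 1"] rv by simp
      qed
    qed
    then obtain y where y: "y \<in> ?O" "f y = r (f u)" by blast
    have uO: "u \<notin> ?O" using u(2) TS(1) by blast
    have fT: "f \<in> insert u T \<rightarrow> insert u T" using TS(3) u(3) by auto
    have "restrict (r(u := y)) (insert u T) \<in> equivariant f (insert u T) ?O"
    proof (rule restrict_in_equivariant[OF fT])
      show "(r(u := y)) x \<in> ?O" if "x \<in> insert u T" for x
        using that r(1) y(1) by (auto simp: equivariant_def)
      have "f x \<noteq> u" if "x \<in> T" for x using that TS(3) u(2) by auto
      then show "(r(u := y)) (f x) = f ((r(u := y)) x)" if "x \<in> insert u T" for x
        using that r(1) y(2) u by (auto simp: equivariant_def)
    qed
    moreover have "restrict (r(u := y)) (insert u T) x = x" if "x \<in> ?O" for x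
      using that uO TS(1) r(2) by auto
    ultimately have "P (insert u T)"
      unfolding P_def using TS u(1) fT by blast
    then have "card (insert u T) \<le> card T" by (rule Tmax)
    moreover have "finite T" using TS(2) S(1) finite_subset by blast
    ultimately show False using u(2) by simp
  qed
  then show ?thesis using r by blast
qed

text \<open>
  Retracting onto the orbit of \<open>v\<close> and then sending \<open>v\<close> anywhere makes evaluation at \<open>v\<close>
  surjective. If it is also injective, the retraction and the identity coincide.
\<close>

lemma indecomposable_card_equivariant:
  assumes S: "finite S" "f \<in> S \<rightarrow> S" "S \<noteq> {}" and ind: "indecomposable f S"
  shows "card S \<le> card (equivariant f S S) \<and>
    (card (equivariant f S S) = card S \<longrightarrow> (\<exists>v\<in>S. S = forward_orbit f v))"
proof -
  have "finite (preperiod f ` S)" "preperiod f ` S \<noteq> {}" using S by auto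
  then have "Max (preperiod f ` S) \<in> preperiod f ` S" by (rule Max_in)
  then obtain v where v: "v \<in> S" "preperiod f v = Max (preperiod f ` S)" by auto
  then have max: "preperiod f w \<le> preperiod f v" if "w \<in> S" for w
    using that S(1) by simp
  let ?O = "forward_orbit f v"
  obtain r where r: "r \<in> equivariant f S ?O" "\<And>x. x \<in> ?O \<Longrightarrow> r x = x"
    using retraction_onto_orbit[OF S(1,2) ind v(1) max] by blast
  have surj: "\<exists>g \<in> equivariant f S S. g v = w" if w: "w \<in> S" for w
  proof -
    \<comment> \<open>\<open>r x\<close> may be several iterates of \<open>v\<close>; the choice is immaterial because of \<open>rel\<close> below\<close>
    define k where "k x = (SOME i. (f ^^ i) v = r x)" for x
    have k: "(f ^^ k x) v = r x" if x: "x \<in> S" for x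
    proof -
      have "r x \<in> ?O" using r(1) x by (auto simp: equivariant_def)
      then have "\<exists>i. (f ^^ i) v = r x" by (auto simp: forward_orbit_def)
      then show ?thesis unfolding k_def by (rule someI_ex)
    qed
    note rel = max_preperiod_relations[OF S(1,2) ind v(1) w max[OF w]]
    have "(\<lambda>x\<in>S. (f ^^ k x) w) \<in> equivariant f S S"
    proof (rule restrict_in_equivariant[OF S(2)])
      show "(f ^^ k x) w \<in> S" for x by (rule funpow_closed[OF S(2) w])
      fix x assume x: "x \<in> S"
      have "(f ^^ k (f x)) v = (f ^^ Suc (k x)) v"
        using k[OF x] k[OF funcset_mem[OF S(2) x]] x r(1) by (simp add: equivariant_def)
      then show "(f ^^ k (f x)) w = f ((f ^^ k x) w)" using rel[of "k (f x)" "Suc (k x)"] by simp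
    qed
    moreover have "(f ^^ k v) v = (f ^^ 0) v"
      using k[OF v(1)] r(2)[OF self_in_forward_orbit] by simp
    then have "(f ^^ k v) w = w" using rel[of "k v" 0] by simp
    ultimately show ?thesis using v(1) by (intro bexI) auto
  qed
  have fin: "finite (equivariant f S S)" using finite_equivariant S(1) by blast
  have image: "(\<lambda>g. g v) ` equivariant f S S = S"
    using surj v(1) by (force simp: equivariant_def)
  have le: "card S \<le> card (equivariant f S S)"
    using card_image_le[OF fin, of "\<lambda>g. g v"] image by simp
  moreover have "S = ?O" if "card (equivariant f S S) = card S"
  proof -
    have inj: "inj_on (\<lambda>g. g v) (equivariant f S S)"
      using that image fin by (intro eq_card_imp_inj_on) auto
    have OS: "?O \<subseteq> S" by (rule forward_orbit_subset[OF S(2) v(1)])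
    have "r \<in> equivariant f S S" using r(1) equivariant_mono[OF OS] by blast
    moreover have "restrict (\<lambda>x. x) S \<in> equivariant f S S"
      by (intro restrict_in_equivariant S(2)) auto
    moreover have "r v = restrict (\<lambda>x. x) S v" using r(2)[OF self_in_forward_orbit] v(1) by simp
    ultimately have "r = restrict (\<lambda>x. x) S" using inj unfolding inj_on_def by blast
    then have "x \<in> ?O" if "x \<in> S" for x
      using that r(1) PiE_mem[of r S "\<lambda>_. ?O" x] by (simp add: equivariant_def)
    then show ?thesis using OS by blast
  qed
  ultimately show ?thesis using v(1) by blast
qed

section \<open>Decomposable maps\<close>

lemma card_equivariant_split:
  assumes "finite A" "finite B" "A \<inter> B = {}" "f \<in> A \<rightarrow> A" "f \<in> B \<rightarrow> B"
  shows "card (equivariant f A (A \<union> B)) * card (equivariant f B (A \<union> B))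
    \<le> card (equivariant f (A \<union> B) (A \<union> B))"
proof -
  let ?S = "A \<union> B"
  define glue where "glue = (\<lambda>(g, h). \<lambda>x\<in>?S. if x \<in> A then g x else h x :: 'a)"
  have glue_A: "glue (g, h) x = g x" if "x \<in> A" for g h x using that by (simp add: glue_def)
  have glue_B: "glue (g, h) x = h x" if "x \<in> B" for g h x
    using that assms(3) by (auto simp: glue_def)
  have "inj_on glue (equivariant f A ?S \<times> equivariant f B ?S)"
  proof (rule inj_onI, clarify, rule conjI)
    fix g h g' h'
    assume g: "g \<in> equivariant f A ?S" "g' \<in> equivariant f A ?S"
      and h: "h \<in> equivariant f B ?S" "h' \<in> equivariant f B ?S"
      and eq: "glue (g, h) = glue (g', h')"
    have "g x = g' x" if "x \<in> A" for x using glue_A[OF that] eq by metis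
    then show "g = g'" using g by (auto simp: equivariant_def intro: PiE_ext)
    have "h x = h' x" if "x \<in> B" for x using glue_B[OF that] eq by metis
    then show "h = h'" using h by (auto simp: equivariant_def intro: PiE_ext)
  qed
  moreover have "glue (g, h) \<in> equivariant f ?S ?S"
    if g: "g \<in> equivariant f A ?S" and h: "h \<in> equivariant f B ?S" for g h
    unfolding glue_def prod.case
  proof (rule restrict_in_equivariant)
    show "f \<in> ?S \<rightarrow> ?S" using assms(4,5) by auto
    fix x assume x: "x \<in> ?S"
    show "(if x \<in> A then g x else h x) \<in> ?S"
      using x g h by (auto simp: equivariant_def PiE_iff)
    show "(if f x \<in> A then g (f x) else h (f x)) = f (if x \<in> A then g x else h x)"
    proof (cases "x \<in> A")
      case True
      then have "f x \<in> A" using assms(4) by blast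
      then show ?thesis using True g by (simp add: equivariant_def)
    next
      case False
      then have "x \<in> B" "f x \<notin> A" using x assms(3,5) by auto
      then show ?thesis using False h by (simp add: equivariant_def)
    qed
  qed
  then have "glue ` (equivariant f A ?S \<times> equivariant f B ?S) \<subseteq> equivariant f ?S ?S" by auto
  moreover have "finite (equivariant f ?S ?S)" using assms(1,2) by (simp add: finite_equivariant)
  ultimately have "card (equivariant f A ?S \<times> equivariant f B ?S) \<le> card (equivariant f ?S ?S)"
    by (rule card_inj_on_le)
  then show ?thesis by (simp add: card_cartesian_product)
qed

lemma card_equivariant_less_union:
  assumes "finite A" "finite B" "A \<noteq> {}" "A \<inter> B = {}" "equivariant f A B \<noteq> {}"
  shows "card (equivariant f A A) < card (equivariant f A (A \<union> B))"
proof (rule psubset_card_mono)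
  show "finite (equivariant f A (A \<union> B))" using assms by (simp add: finite_equivariant)
  obtain g where g: "g \<in> equivariant f A B" using assms(5) by blast
  obtain x where "x \<in> A" using assms(3) by blast
  then have "g x \<notin> A" using g assms(4) by (auto simp: equivariant_def)
  then have "g \<notin> equivariant f A A" using \<open>x \<in> A\<close> by (auto simp: equivariant_def)
  moreover have "g \<in> equivariant f A (A \<union> B)" using g equivariant_mono[of B "A \<union> B" f A] by blast
  moreover have "equivariant f A A \<subseteq> equivariant f A (A \<union> B)" by (rule equivariant_mono) simp
  ultimately show "equivariant f A A \<subset> equivariant f A (A \<union> B)" by blast
qed

lemma two_points_fixed_or_swapped:
  assumes "card A = 2" "f \<in> A \<rightarrow> A"
  shows "(\<exists>p\<in>A. f p = p) \<or> (\<exists>x y. A = {x, y} \<and> x \<noteq> y \<and> f x = y \<and> f y = x)"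
proof -
  obtain x y where A: "A = {x, y}" "x \<noteq> y" using assms(1) by (auto simp: card_2_iff)
  then have "f x = x \<or> f x = y" "f y = x \<or> f y = y" using assms(2) by auto
  then show ?thesis using A by blast
qed

lemma equivariant_between_two_points:
  assumes "card A = 2" "card B = 2" "f \<in> A \<rightarrow> A" "f \<in> B \<rightarrow> B"
  shows "equivariant f A B \<noteq> {} \<or> equivariant f B A \<noteq> {}"
proof -
  consider (fixB) p where "p \<in> B" "f p = p" | (fixA) p where "p \<in> A" "f p = p"
    | (swap) x y x' y' where "A = {x, y}" "x \<noteq> y" "f x = y" "f y = x"
        "B = {x', y'}" "x' \<noteq> y'" "f x' = y'" "f y' = x'"
    using two_points_fixed_or_swapped[OF assms(1,3)] two_points_fixed_or_swapped[OF assms(2,4)]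
    by metis
  then show ?thesis
  proof cases
    case fixB
    then show ?thesis using const_in_equivariant[OF assms(3)] by blast
  next
    case fixA
    then show ?thesis using const_in_equivariant[OF assms(4)] by blast
  next
    case swap
    then have "(\<lambda>z\<in>A. if z = x then x' else y') \<in> equivariant f A B"
      by (intro restrict_in_equivariant assms(3)) auto
    then show ?thesis by blast
  qed
qed

text \<open>
  Since \<open>a * b > a + b\<close> unless \<open>a = b = 2\<close>, gluing endomorphisms of the two parts is enough except
  in that case, where an equivariant map from one part to the other supplies the surplus.
\<close>

lemma card_equivariant_large_parts:
  assumes fin: "finite A" "finite B" and dis: "A \<inter> B = {}"
    and cl: "f \<in> A \<rightarrow> A" "f \<in> B \<rightarrow> B"
    and A: "2 \<le> card A" "card A \<le> card (equivariant f A A)"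
    and B: "2 \<le> card B" "card B \<le> card (equivariant f B B)"
  shows "card (A \<union> B) < card (equivariant f (A \<union> B) (A \<union> B))"
proof -
  define a where "a = card (equivariant f A (A \<union> B))"
  define b where "b = card (equivariant f B (A \<union> B))"
  have "card (equivariant f A A) \<le> a" "card (equivariant f B B) \<le> b"
    unfolding a_def b_def using fin
    by (auto intro!: card_mono finite_equivariant equivariant_mono)
  then have ab: "card A \<le> a" "card B \<le> b" using A B by auto
  have large: "2 \<le> a" "2 \<le> b" using ab A B by auto
  have "a \<noteq> 2 \<or> b \<noteq> 2"
  proof (rule ccontr)
    assume "\<not> (a \<noteq> 2 \<or> b \<noteq> 2)"
    then have two: "a = 2" "b = 2" by auto
    then have cards: "card A = 2" "card B = 2" using ab A B by auto
    have "A \<noteq> {}" "B \<noteq> {}" using cards by auto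
    then have "card (equivariant f A A) < a \<or> card (equivariant f B B) < b"
      using equivariant_between_two_points[OF cards cl] fin dis
        card_equivariant_less_union[of A B f] card_equivariant_less_union[of B A f]
      unfolding a_def b_def by (auto simp: Un_commute Int_commute)
    then show False using two cards A B by auto
  qed
  moreover obtain k l where kl: "a = k + 2" "b = l + 2"
    using large by (metis add.commute le_Suc_ex)
  ultimately have "a + b < a * b" by (cases k; cases l) (auto simp: algebra_simps)
  also have "a * b \<le> card (equivariant f (A \<union> B) (A \<union> B))"
    unfolding a_def b_def by (rule card_equivariant_split[OF fin dis cl])
  finally show ?thesis using ab fin dis by (simp add: card_Un_disjoint)
qed

text \<open>
  The other part \<open>B\<close> has its endomorphisms and the constant map onto the fixed point. A fixed point
  in \<open>B\<close> would be a second possible image of the isolated one.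
\<close>

lemma card_equivariant_isolated_fixed_point:
  assumes fin: "finite B" and p: "p \<notin> B" "f p = p" and cl: "f \<in> B \<rightarrow> B"
    and B: "B \<noteq> {}" "card B \<le> card (equivariant f B B)"
  shows "card (insert p B) \<le> card (equivariant f (insert p B) (insert p B))"
    and "card (equivariant f (insert p B) (insert p B)) = card (insert p B) \<Longrightarrow>
      card (equivariant f B B) = card B \<and> (\<forall>x\<in>B. f x \<noteq> x)"
proof -
  let ?S = "insert p B"
  define a where "a = card (equivariant f {p} ?S)"
  define b where "b = card (equivariant f B ?S)"
  have clp: "f \<in> {p} \<rightarrow> {p}" using p by auto
  have prod: "a * b \<le> card (equivariant f ?S ?S)"
    using card_equivariant_split[of "{p}" B f] fin p cl clp unfolding a_def b_def by simp
  have fin_a: "finite (equivariant f {p} ?S)" using fin by (simp add: finite_equivariant)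
  have p_in: "(\<lambda>_\<in>{p}. p) \<in> equivariant f {p} ?S"
    by (intro const_in_equivariant clp) (use p in auto)
  then have "a \<noteq> 0" unfolding a_def using fin_a by auto
  then have a: "1 \<le> a" by simp
  have "equivariant f B {p} \<noteq> {}" using const_in_equivariant[OF cl, of p "{p}"] p by auto
  then have b: "card (equivariant f B B) < b"
    using card_equivariant_less_union[of B "{p}" f] fin B p unfolding b_def by simp
  have cS: "card ?S = Suc (card B)" using fin p by simp
  have b_le: "b \<le> a * b" using a by simp
  show "card ?S \<le> card (equivariant f ?S ?S)"
    using prod b b_le B cS by linarith
  assume eq: "card (equivariant f ?S ?S) = card ?S"
  then have "a * b \<le> b" using prod b B cS by linarith
  then have "a \<le> 1" using b by simp
  have "f q \<noteq> q" if q: "q \<in> B" for q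
  proof
    assume "f q = q"
    then have q_in: "(\<lambda>_\<in>{p}. q) \<in> equivariant f {p} ?S"
      by (intro const_in_equivariant clp) (use q in auto)
    have "p \<noteq> q" using p q by blast
    then have "(\<lambda>_\<in>{p}. p) \<noteq> (\<lambda>_\<in>{p}. q)" by (metis restrict_apply' singletonI)
    then show False
      using \<open>a \<le> 1\<close> fin_a p_in q_in card_le_Suc0_iff_eq[OF fin_a] unfolding a_def by auto
  qed
  moreover have "card (equivariant f B B) = card B"
    using prod b b_le B cS eq by linarith
  ultimately show "card (equivariant f B B) = card B \<and> (\<forall>x\<in>B. f x \<noteq> x)" by blast
qed

definition nearly_single_orbit :: "('a \<Rightarrow> 'a) \<Rightarrow> 'a set \<Rightarrow> bool" where
  "nearly_single_orbit f S \<longleftrightarrow> (\<exists>v. S = forward_orbit f v) \<or>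
     (\<exists>p\<in>S. f p = p \<and> (\<exists>v. S - {p} = forward_orbit f v) \<and> (\<forall>x\<in>S - {p}. f x \<noteq> x))"

text \<open>
  In the case of equality, a part that is a fixed point leaves a part without fixed points. This
  rules out the second alternative of \<open>nearly_single_orbit\<close> for that part, so at most one isolated
  fixed point is ever split off.
\<close>

lemma card_equivariant_ge:
  assumes "finite S" "f \<in> S \<rightarrow> S" "S \<noteq> {}"
  shows "card S \<le> card (equivariant f S S) \<and>
    (card (equivariant f S S) = card S \<longrightarrow> nearly_single_orbit f S)"
  using assms
proof (induction "card S" arbitrary: S rule: less_induct)
  case less
  note S = less.prems
  show ?case
  proof (cases "indecomposable f S")
    case True
    then show ?thesis
      using indecomposable_card_equivariant[OF S True] unfolding nearly_single_orbit_def by blast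
  next
    case False
    then obtain A where A: "A \<subseteq> S" "A \<noteq> {}" "A \<noteq> S" "f \<in> A \<rightarrow> A" "f \<in> (S - A) \<rightarrow> (S - A)"
      unfolding indecomposable_def by blast
    have IH: "card T \<le> card (equivariant f T T) \<and>
        (card (equivariant f T T) = card T \<longrightarrow> nearly_single_orbit f T)"
      if "T \<subset> S" "f \<in> T \<rightarrow> T" "T \<noteq> {}" for T
      using less.hyps[of T] that psubset_card_mono[OF S(1) that(1)] finite_subset[of T S] S(1)
      by blast
    have point: ?thesis if p: "p \<in> S" "f p = p" and cl: "f \<in> (S - {p}) \<rightarrow> (S - {p})"
      and ne: "S - {p} \<noteq> {}" for p
    proof -
      let ?B = "S - {p}"
      have B: "card ?B \<le> card (equivariant f ?B ?B)"
        "card (equivariant f ?B ?B) = card ?B \<longrightarrow> nearly_single_orbit f ?B"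
        using IH[of ?B] p cl ne by auto
      have "insert p ?B = S" using p by blast
      then have ge: "card S \<le> card (equivariant f S S)"
        and eq: "card (equivariant f S S) = card S \<Longrightarrow>
          card (equivariant f ?B ?B) = card ?B \<and> (\<forall>x\<in>?B. f x \<noteq> x)"
        using card_equivariant_isolated_fixed_point[of ?B p f] S(1) p cl ne B(1) by auto
      have "nearly_single_orbit f S" if "card (equivariant f S S) = card S"
      proof -
        have "nearly_single_orbit f ?B" and nofix: "\<forall>x\<in>?B. f x \<noteq> x"
          using eq[OF that] B(2) by auto
        then have "\<exists>v. ?B = forward_orbit f v" unfolding nearly_single_orbit_def by blast
        then show ?thesis unfolding nearly_single_orbit_def using p nofix by blast
      qed
      then show ?thesis using ge by blast
    qed
    have finA: "finite A" "finite (S - A)" using A(1) S(1) finite_subset by auto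
    have "card A \<noteq> 0" "card (S - A) \<noteq> 0" using A finA by auto
    then consider "card A = 1" | "card (S - A) = 1" | "2 \<le> card A" "2 \<le> card (S - A)"
      by linarith
    then show ?thesis
    proof cases
      case 1
      then obtain p where "A = {p}" by (auto simp: card_1_singleton_iff)
      then show ?thesis using point[of p] A by auto
    next
      case 2
      then obtain p where p: "S - A = {p}" by (auto simp: card_1_singleton_iff)
      then have "S - {p} = A" using A(1) by blast
      then show ?thesis using point[of p] A p by auto
    next
      case 3
      have "A \<union> (S - A) = S" using A(1) by blast
      then have "card S < card (equivariant f S S)"
        using card_equivariant_large_parts[of A "S - A" f] finA A 3 IH[of A] IH[of "S - A"]
        by (auto simp: psubset_eq)
      then show ?thesis by simp
    qed
  qed
qed

lemma card_equivariant_eq_iff: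
  assumes "finite S" "f \<in> S \<rightarrow> S" "S \<noteq> {}"
  shows "card (equivariant f S S) = card S \<longleftrightarrow> nearly_single_orbit f S"
proof
  assume "card (equivariant f S S) = card S"
  then show "nearly_single_orbit f S" using card_equivariant_ge[OF assms] by blast
next
  assume near: "nearly_single_orbit f S"
  have "card (equivariant f S S) \<le> card S"
  proof (cases "\<exists>v. S = forward_orbit f v")
    case True
    then obtain v where v: "S = forward_orbit f v" by blast
    then have "v \<in> S" using self_in_forward_orbit[of v f] by simp
    then show ?thesis using v by (intro card_equivariant_le[OF assms(1,2)]) auto
  next
    case False
    then obtain p v where p: "p \<in> S" "f p = p" and v: "S - {p} = forward_orbit f v"
      and nofix: "\<forall>x\<in>S - {p}. f x \<noteq> x"
      using near unfolding nearly_single_orbit_def by blast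
    show ?thesis
    proof (rule card_equivariant_le[OF assms(1,2)])
      show "v \<in> S" using self_in_forward_orbit[of v f] v by blast
      fix x y assume "x \<in> S - forward_orbit f v" "y \<in> S"
      then show "f y = y \<longleftrightarrow> y = x" using v p nofix by (metis Diff_iff singletonD singletonI)
    qed
  qed
  then show "card (equivariant f S S) = card S" using card_equivariant_ge[OF assms] by simp
qed


section \<open>Functional graphs up to isomorphism\<close>

definition conjugate :: "'a set \<Rightarrow> ('a \<Rightarrow> 'a) \<Rightarrow> 'b set \<Rightarrow> ('b \<Rightarrow> 'b) \<Rightarrow> bool" where
  "conjugate S f T h \<longleftrightarrow> (\<exists>\<phi>. bij_betw \<phi> S T \<and> (\<forall>x\<in>S. \<phi> (f x) = h (\<phi> x)))"

lemma isomorphic_functional_graph_iff: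
  assumes f: "f \<in> S \<rightarrow> S"
  shows "isomorphic (functional_graph S f) (functional_graph T h) \<longleftrightarrow> conjugate S f T h"
proof
  let ?G = "with_proj (functional_graph S f)" and ?H = "with_proj (functional_graph T h)"
  assume "isomorphic (functional_graph S f) (functional_graph T h)"
  then obtain i where i: "pre_digraph.digraph_isomorphism ?G i" and H: "?H = app_iso i ?G"
    by (auto simp: isomorphic_def digraph_iso_def)
  have "inj_on (iso_verts i) S"
    using pre_digraph.digraph_isomorphism_inj_on_verts[OF i] by (simp add: functional_graph_def)
  moreover have "iso_verts i ` S = T"
    using arg_cong[OF H, of verts] by (simp add: functional_graph_def)
  moreover have "iso_verts i (f s) = h (iso_verts i s)" if "s \<in> S" for s
  proof -
    have arc: "(s, f s) \<in> arcs ?G" using that by (auto simp: functional_graph_def)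
    then have "iso_arcs i (s, f s) \<in> arcs ?H" unfolding H by simp
    then obtain t where t: "iso_arcs i (s, f s) = (t, h t)" by (auto simp: functional_graph_def)
    have tail: "iso_tail i = fst" and head: "iso_head i = snd"
      using arg_cong[OF H, of tail] arg_cong[OF H, of head] by simp_all
    show ?thesis
      using pre_digraph.iso_verts_tail[OF i arc] pre_digraph.iso_verts_head[OF i arc] t tail head
      by simp
  qed
  ultimately show "conjugate S f T h" unfolding conjugate_def bij_betw_def by blast
next
  let ?G = "with_proj (functional_graph S f)" and ?H = "with_proj (functional_graph T h)"
  assume "conjugate S f T h"
  then obtain \<phi> where \<phi>: "inj_on \<phi> S" "\<phi> ` S = T" "\<And>x. x \<in> S \<Longrightarrow> \<phi> (f x) = h (\<phi> x)"
    unfolding conjugate_def bij_betw_def by blast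
  define i where "i = \<lparr> iso_verts = \<phi>, iso_arcs = map_prod \<phi> \<phi>, iso_head = snd, iso_tail = fst \<rparr>"
  have "wf_digraph ?G"
    using f by unfold_locales (auto simp: functional_graph_def)
  moreover have "inj_on (map_prod \<phi> \<phi>) {(s, f s) | s. s \<in> S}"
    using \<phi>(1) by (auto simp: inj_on_def)
  ultimately have "pre_digraph.digraph_isomorphism ?G i"
    using \<phi>(1) by (simp add: pre_digraph.digraph_isomorphism_def i_def functional_graph_def)
  moreover have "map_prod \<phi> \<phi> ` {(s, f s) | s. s \<in> S} = {(t, h t) | t. t \<in> T}"
    using \<phi>(2,3) by force
  then have "?H = app_iso i ?G"
    using \<phi>(2) by (simp add: app_iso_def i_def functional_graph_def with_proj_def)
  ultimately show "isomorphic (functional_graph S f) (functional_graph T h)"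
    unfolding isomorphic_def digraph_iso_def by blast
qed

lemma conjugate_sym:
  assumes "f \<in> S \<rightarrow> S" "conjugate S f T h"
  shows "conjugate T h S f"
proof -
  obtain \<phi> where \<phi>: "bij_betw \<phi> S T" "\<And>x. x \<in> S \<Longrightarrow> \<phi> (f x) = h (\<phi> x)"
    using assms(2) unfolding conjugate_def by blast
  let ?\<psi> = "inv_into S \<phi>"
  have "?\<psi> (h y) = f (?\<psi> y)" if y: "y \<in> T" for y
  proof -
    have "?\<psi> y \<in> S" using \<phi>(1) y by (auto simp: bij_betw_def inv_into_into)
    then have "f (?\<psi> y) \<in> S" "\<phi> (f (?\<psi> y)) = h y"
      using assms(1) \<phi> y by (auto simp: bij_betw_inv_into_right)
    then show ?thesis using \<phi>(1) by (metis bij_betw_inv_into_left)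
  qed
  then show ?thesis unfolding conjugate_def using bij_betw_inv_into[OF \<phi>(1)] by blast
qed

lemma conjugate_forward_orbit:
  assumes "f \<in> forward_orbit f v \<rightarrow> forward_orbit f v" "conjugate (forward_orbit f v) f T h"
  shows "\<exists>w. T = forward_orbit h w"
proof -
  obtain \<phi> where \<phi>: "bij_betw \<phi> (forward_orbit f v) T"
    "\<And>x. x \<in> forward_orbit f v \<Longrightarrow> \<phi> (f x) = h (\<phi> x)"
    using assms(2) unfolding conjugate_def by blast
  have pow: "\<phi> ((f ^^ i) v) = (h ^^ i) (\<phi> v)" for i
  proof (induction i)
    case (Suc i)
    have "(f ^^ i) v \<in> forward_orbit f v" by (simp add: forward_orbit_def)
    then show ?case using \<phi>(2) Suc by simp
  qed simp
  have "T = \<phi> ` forward_orbit f v" using \<phi>(1) by (simp add: bij_betw_def)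
  also have "\<dots> = forward_orbit h (\<phi> v)" by (simp add: forward_orbit_def image_image pow)
  finally show ?thesis by blast
qed

lemma conjugate_fixed_point_iff:
  assumes "f \<in> S \<rightarrow> S" "conjugate S f T h"
  shows "(\<exists>x\<in>S. f x = x) \<longleftrightarrow> (\<exists>y\<in>T. h y = y)"
proof -
  obtain \<phi> where \<phi>: "inj_on \<phi> S" "T = \<phi> ` S" "\<And>x. x \<in> S \<Longrightarrow> \<phi> (f x) = h (\<phi> x)"
    using assms(2) unfolding conjugate_def bij_betw_def by blast
  have "h (\<phi> x) = \<phi> x \<longleftrightarrow> f x = x" if "x \<in> S" for x
    using that \<phi>(3)[OF that, symmetric] inj_on_eq_iff[OF \<phi>(1)] assms(1) by auto
  then show ?thesis using \<phi>(2) by auto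
qed

lemma disjoint_union_functional_graph:
  "disjoint_union (functional_graph S f) (functional_graph T h)
    = functional_graph (S <+> T) (map_sum f h)"
  unfolding disjoint_union_def functional_graph_def
  by (auto simp: image_iff Bex_def)

lemma Z1_functional_graph: "Z1 = functional_graph {()} id"
  by (auto simp: Z1_def functional_graph_def)

lemma conjugate_isolated_fixed_point_iff:
  assumes "f \<in> S \<rightarrow> S" "h \<in> T \<rightarrow> T"
  shows "conjugate S f ({()} <+> T) (map_sum id h) \<longleftrightarrow>
    (\<exists>p\<in>S. f p = p \<and> f \<in> (S - {p}) \<rightarrow> (S - {p}) \<and> conjugate (S - {p}) f T h)"
proof
  assume "conjugate S f ({()} <+> T) (map_sum id h)"
  then obtain \<phi> where \<phi>: "inj_on \<phi> S" "\<phi> ` S = {()} <+> T"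
    and comm: "\<And>x. x \<in> S \<Longrightarrow> \<phi> (f x) = map_sum id h (\<phi> x)"
    unfolding conjugate_def bij_betw_def by blast
  have "Inl () \<in> \<phi> ` S" unfolding \<phi>(2) by blast
  then obtain p where p: "p \<in> S" "\<phi> p = Inl ()" by force
  have "\<phi> (f p) = \<phi> p" using comm[OF p(1)] p(2) by simp
  then have "f p = p" using \<phi>(1) p(1) assms(1) by (auto dest: inj_onD)
  have Inr: "\<exists>t\<in>T. \<phi> x = Inr t" if x: "x \<in> S - {p}" for x
  proof -
    have "\<phi> x \<in> {()} <+> T" unfolding \<phi>(2)[symmetric] using x by blast
    moreover have "\<phi> x \<noteq> Inl ()" using x p \<phi>(1) by (metis Diff_iff inj_onD singletonI)
    ultimately show ?thesis by auto
  qed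
  have cl: "f \<in> (S - {p}) \<rightarrow> (S - {p})"
  proof
    fix x assume x: "x \<in> S - {p}"
    then obtain t where "\<phi> x = Inr t" using Inr by blast
    then have "\<phi> (f x) \<noteq> \<phi> p" using comm[of x] x p by simp
    then show "f x \<in> S - {p}" using x assms(1) by auto
  qed
  define \<psi> where "\<psi> x = projr (\<phi> x)" for x
  have \<psi>: "\<phi> x = Inr (\<psi> x)" "\<psi> x \<in> T" if "x \<in> S - {p}" for x
    using Inr[OF that] by (auto simp: \<psi>_def)
  have "bij_betw \<psi> (S - {p}) T"
  proof (rule bij_betw_imageI)
    show "inj_on \<psi> (S - {p})"
    proof
      fix x y assume xy: "x \<in> S - {p}" "y \<in> S - {p}" "\<psi> x = \<psi> y"
      then have "\<phi> x = \<phi> y" by (simp add: \<psi>(1))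
      then show "x = y" using \<phi>(1) xy by (auto dest: inj_onD)
    qed
    have "t \<in> \<psi> ` (S - {p})" if "t \<in> T" for t
    proof -
      have "Inr t \<in> \<phi> ` S" unfolding \<phi>(2) using that by blast
      then obtain x where x: "x \<in> S" "\<phi> x = Inr t" by force
      then have "x \<in> S - {p}" using p by auto
      then show ?thesis using \<psi>(1)[of x] x by auto
    qed
    then show "\<psi> ` (S - {p}) = T" using \<psi>(2) by blast
  qed
  moreover have "\<psi> (f x) = h (\<psi> x)" if x: "x \<in> S - {p}" for x
    using \<psi>(1)[OF x] \<psi>(1)[OF funcset_mem[OF cl x]] comm[of x] x by simp
  ultimately have "conjugate (S - {p}) f T h" unfolding conjugate_def by blast
  then show "\<exists>p\<in>S. f p = p \<and> f \<in> (S - {p}) \<rightarrow> (S - {p}) \<and> conjugate (S - {p}) f T h"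
    using p(1) \<open>f p = p\<close> cl by blast
next
  assume "\<exists>p\<in>S. f p = p \<and> f \<in> (S - {p}) \<rightarrow> (S - {p}) \<and> conjugate (S - {p}) f T h"
  then obtain p \<psi> where p: "p \<in> S" "f p = p" and cl: "f \<in> (S - {p}) \<rightarrow> (S - {p})"
    and \<psi>: "inj_on \<psi> (S - {p})" "\<psi> ` (S - {p}) = T"
    and comm: "\<And>x. x \<in> S - {p} \<Longrightarrow> \<psi> (f x) = h (\<psi> x)"
    unfolding conjugate_def bij_betw_def by blast
  define \<phi> where "\<phi> x = (if x = p then Inl () else Inr (\<psi> x))" for x
  have "inj_on \<phi> S" using \<psi>(1) by (auto simp: inj_on_def \<phi>_def)
  moreover have "\<phi> ` S = {()} <+> T"
  proof -
    have "\<phi> ` S = insert (Inl ()) (Inr ` \<psi> ` (S - {p}))" using p(1) by (auto simp: \<phi>_def)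
    then show ?thesis unfolding \<psi>(2) by auto
  qed
  moreover have "\<phi> (f x) = map_sum id h (\<phi> x)" if "x \<in> S" for x
  proof (cases "x = p")
    case True
    then show ?thesis using p by (simp add: \<phi>_def)
  next
    case False
    then have x: "x \<in> S - {p}" using that by blast
    then have "f x \<noteq> p" using cl by blast
    then show ?thesis using False comm[OF x] by (simp add: \<phi>_def)
  qed
  ultimately show "conjugate S f ({()} <+> T) (map_sum id h)"
    unfolding conjugate_def bij_betw_def by blast
qed


section \<open>Single orbits are the graphs of a cycle with a tail\<close>

text \<open>The first iterate that repeats an earlier one closes the orbit.\<close>

lemma forward_orbit_enumeration:
  assumes "finite (forward_orbit f v)"
  defines "n \<equiv> card (forward_orbit f v)"
  shows "bij_betw (\<lambda>i. (f ^^ i) v) {..<n} (forward_orbit f v)"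
    and "\<exists>t<n. (f ^^ n) v = (f ^^ t) v"
proof -
  let ?e = "\<lambda>i. (f ^^ i) v"
  have "\<not> inj ?e" using assms(1) unfolding forward_orbit_def by (auto dest: finite_imageD)
  then obtain i j where ij: "i \<noteq> j" "?e i = ?e j" by (auto simp: inj_def)
  then have "\<exists>j. \<exists>i<j. ?e i = ?e j" by (metis nat_neq_iff)
  then obtain k where k: "\<exists>i<k. ?e i = ?e k" and kmin: "\<And>j. j < k \<Longrightarrow> \<not> (\<exists>i<j. ?e i = ?e j)"
    using exists_least_iff[of "\<lambda>j. \<exists>i<j. ?e i = ?e j"] by blast
  obtain t where t: "t < k" "?e t = ?e k" using k by blast
  have inj: "inj_on ?e {..<k}"
  proof
    fix i j assume "i \<in> {..<k}" "j \<in> {..<k}" and eq: "?e i = ?e j"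
    then have "\<not> i < j" "\<not> j < i" using kmin[of i] kmin[of j] by (force, force)
    then show "i = j" by simp
  qed
  have "?e i \<in> ?e ` {..<k}" for i
  proof (induction i)
    case 0
    then show ?case using t(1) by (intro image_eqI[of _ _ 0]) auto
  next
    case (Suc i)
    then obtain l where l: "l < k" "?e i = ?e l" by auto
    then have step: "?e (Suc i) = ?e (Suc l)" by simp
    show ?case
    proof (cases "Suc l = k")
      case True
      then show ?thesis using t step by (intro image_eqI[of _ _ t]) auto
    next
      case False
      then show ?thesis using l(1) step by (intro image_eqI[of _ _ "Suc l"]) auto
    qed
  qed
  then have orbit: "forward_orbit f v = ?e ` {..<k}" unfolding forward_orbit_def by auto
  then have "n = k" unfolding n_def using card_image[OF inj] by simp
  then show "bij_betw ?e {..<n} (forward_orbit f v)" "\<exists>t<n. ?e n = ?e t"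
    using inj orbit t by (auto simp: bij_betw_def intro: exI[of _ t])
qed

text \<open>
  An orbit is determined up to isomorphism by its size and the place where it runs into itself.
\<close>

lemma conjugate_if_same_return:
  assumes e: "bij_betw (\<lambda>i. (f ^^ i) v) {..<n} S" and e': "bij_betw (\<lambda>i. (h ^^ i) w) {..<n} T"
    and t: "t < n" "(f ^^ n) v = (f ^^ t) v" "(h ^^ n) w = (h ^^ t) w"
  shows "conjugate S f T h"
proof -
  define ix where "ix = inv_into {..<n} (\<lambda>i. (f ^^ i) v)"
  define \<phi> where "\<phi> = (\<lambda>i. (h ^^ i) w) \<circ> ix"
  have \<phi>: "\<phi> ((f ^^ i) v) = (h ^^ i) w" if "i < n" for i
    using bij_betw_inv_into_left[OF e, of i] that by (simp add: \<phi>_def ix_def)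
  have "bij_betw \<phi> S T"
    unfolding \<phi>_def using bij_betw_inv_into[OF e] e' by (auto simp: ix_def intro: bij_betw_trans)
  moreover have "\<phi> (f x) = h (\<phi> x)" if "x \<in> S" for x
  proof -
    have "x \<in> (\<lambda>i. (f ^^ i) v) ` {..<n}" using that e by (simp add: bij_betw_def)
    then obtain i where i: "i < n" "x = (f ^^ i) v" by auto
    have fx: "f x = (f ^^ Suc i) v" and hx: "h (\<phi> x) = (h ^^ Suc i) w" using i \<phi> by auto
    show ?thesis
    proof (cases "Suc i = n")
      case True
      then show ?thesis unfolding fx hx using t \<phi>[OF t(1)] by simp
    next
      case False
      then show ?thesis unfolding fx hx using i(1) \<phi>[of "Suc i"] by simp
    qed
  qed
  ultimately show ?thesis unfolding conjugate_def by blast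
qed

definition tailed_cycle :: "nat \<Rightarrow> nat \<Rightarrow> nat" where
  "tailed_cycle m i = (if i < m then Suc i mod m else if i = m then 0 else i - 1)"

text \<open>
  A generator of the whole graph: the vertex where the tail starts, and any cycle vertex if there
  is no tail. In the latter case \<open>0\<close> is taken, so that \<open>tailed_cycle_funpow\<close> also covers it.
\<close>

definition tail_end :: "nat \<Rightarrow> nat \<Rightarrow> nat" where
  "tail_end m t = (if t = 0 then 0 else m + t - 1)"

lemma U_functional_graph: "U m t = functional_graph {..<m + t} (tailed_cycle m)"
  unfolding U_def tailed_cycle_def by (rule refl)

lemma tailed_cycle_closed:
  assumes "1 \<le> m"
  shows "tailed_cycle m \<in> {..<m + t} \<rightarrow> {..<m + t}"
proof
  fix i assume "i \<in> {..<m + t}"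
  moreover have "Suc i mod m < m" using assms by simp
  ultimately show "tailed_cycle m i \<in> {..<m + t}" by (auto simp: tailed_cycle_def)
qed

text \<open>The walk runs down the tail during the first \<open>t\<close> steps and then up the cycle from \<open>0\<close>.\<close>

lemma tailed_cycle_funpow:
  assumes "1 \<le> m" "i < m + t"
  shows "(tailed_cycle m ^^ i) (tail_end m t) = (if i < t then m + t - 1 - i else i - t)"
  using assms(2)
proof (induction i)
  case 0
  then show ?case by (simp add: tail_end_def)
next
  case (Suc i)
  then have IH: "(tailed_cycle m ^^ i) (tail_end m t) = (if i < t then m + t - 1 - i else i - t)"
    by simp
  have "(tailed_cycle m ^^ Suc i) (tail_end m t) =
      tailed_cycle m (if i < t then m + t - 1 - i else i - t)"
    by (simp add: IH)
  also have "\<dots> = (if Suc i < t then m + t - 1 - Suc i else Suc i - t)"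
  proof -
    consider "Suc i < t" | "Suc i = t" | "t \<le> i" by linarith
    then show ?thesis using Suc.prems by cases (auto simp: tailed_cycle_def)
  qed
  finally show ?case .
qed

lemma tailed_cycle_return:
  assumes "1 \<le> m"
  shows "(tailed_cycle m ^^ (m + t)) (tail_end m t) = (tailed_cycle m ^^ t) (tail_end m t)"
proof -
  obtain k where k: "m = Suc k" using assms by (cases m) auto
  have "(tailed_cycle m ^^ (k + t)) (tail_end m t) = k"
    using tailed_cycle_funpow[OF assms, of "k + t" t] k by simp
  then have "(tailed_cycle m ^^ (m + t)) (tail_end m t) = 0" by (simp add: k tailed_cycle_def)
  then show ?thesis using tailed_cycle_funpow[OF assms, of t t] assms by simp
qed

lemma tailed_cycle_enumeration:
  assumes "1 \<le> m"
  shows "bij_betw (\<lambda>i. (tailed_cycle m ^^ i) (tail_end m t)) {..<m + t} {..<m + t}"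
proof -
  let ?e = "\<lambda>i. (tailed_cycle m ^^ i) (tail_end m t)"
  have "inj_on ?e {..<m + t}"
    using tailed_cycle_funpow[OF assms] by (intro inj_onI) (auto split: if_splits)
  moreover have "?e ` {..<m + t} \<subseteq> {..<m + t}"
    using tailed_cycle_funpow[OF assms] by auto
  ultimately show ?thesis by (simp add: bij_betw_def endo_inj_surj)
qed

lemma tailed_cycle_single_orbit:
  assumes "1 \<le> m"
  shows "{..<m + t} = forward_orbit (tailed_cycle m) (tail_end m t)"
proof
  show "{..<m + t} \<subseteq> forward_orbit (tailed_cycle m) (tail_end m t)"
    using tailed_cycle_enumeration[OF assms, of t] unfolding bij_betw_def forward_orbit_def by blast
  have "tail_end m t < m + t" using assms by (auto simp: tail_end_def)
  then show "forward_orbit (tailed_cycle m) (tail_end m t) \<subseteq> {..<m + t}"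
    by (intro forward_orbit_subset tailed_cycle_closed assms) simp
qed

lemma tailed_cycle_fixed_point_iff:
  assumes "1 \<le> m"
  shows "(\<exists>i\<in>{..<m + t}. tailed_cycle m i = i) \<longleftrightarrow> m = 1"
proof
  assume "\<exists>i\<in>{..<m + t}. tailed_cycle m i = i"
  then obtain i where "tailed_cycle m i = i" by blast
  then show "m = 1"
    using assms by (cases "Suc i = m") (auto simp: tailed_cycle_def split: if_splits)
next
  assume "m = 1"
  then have "tailed_cycle m 0 = 0" by (simp add: tailed_cycle_def)
  then show "\<exists>i\<in>{..<m + t}. tailed_cycle m i = i" using assms by force
qed

lemma single_orbit_iff_conjugate_tailed_cycle:
  assumes "finite S" "f \<in> S \<rightarrow> S" "card S = n"
  shows "(\<exists>v. S = forward_orbit f v) \<longleftrightarrow>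
    (\<exists>m. 1 \<le> m \<and> m \<le> n \<and> conjugate S f {..<m + (n - m)} (tailed_cycle m))"
proof
  assume "\<exists>v. S = forward_orbit f v"
  then obtain v where v: "S = forward_orbit f v" by blast
  have e: "bij_betw (\<lambda>i. (f ^^ i) v) {..<n} S" and "\<exists>t<n. (f ^^ n) v = (f ^^ t) v"
    using forward_orbit_enumeration[of f v] assms v by auto
  then obtain t where t: "t < n" "(f ^^ n) v = (f ^^ t) v" by blast
  define m where "m = n - t"
  have m: "1 \<le> m" "m \<le> n" "n = m + t" "n - m = t" using t(1) by (auto simp: m_def)
  have "conjugate S f {..<m + t} (tailed_cycle m)"
  proof (rule conjugate_if_same_return)
    show "bij_betw (\<lambda>i. (f ^^ i) v) {..<m + t} S" using e m(3) by simp
    show "bij_betw (\<lambda>i. (tailed_cycle m ^^ i) (tail_end m t)) {..<m + t} {..<m + t}"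
      by (rule tailed_cycle_enumeration[OF m(1)])
    show "(tailed_cycle m ^^ (m + t)) (tail_end m t) = (tailed_cycle m ^^ t) (tail_end m t)"
      by (rule tailed_cycle_return[OF m(1)])
    show "t < m + t" "(f ^^ (m + t)) v = (f ^^ t) v" using t m(1,3) by auto
  qed
  then show "\<exists>m. 1 \<le> m \<and> m \<le> n \<and> conjugate S f {..<m + (n - m)} (tailed_cycle m)"
    using m(1,2) unfolding m(4)[symmetric] by blast
next
  assume "\<exists>m. 1 \<le> m \<and> m \<le> n \<and> conjugate S f {..<m + (n - m)} (tailed_cycle m)"
  then obtain m where m: "1 \<le> m" and "conjugate S f {..<m + (n - m)} (tailed_cycle m)" by blast
  then have "conjugate {..<m + (n - m)} (tailed_cycle m) S f" using conjugate_sym assms(2) by blast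
  then show "\<exists>v. S = forward_orbit f v"
    unfolding tailed_cycle_single_orbit[OF m]
    by (intro conjugate_forward_orbit) (rule forward_orbit_closed)
qed

text \<open>
  The absence of further fixed points is what turns the bound \<open>1 \<le> m\<close> for a single orbit into
  \<open>2 \<le> m\<close> for the union, since a cycle with a tail has a fixed point just when its cycle is a loop.
\<close>

lemma nearly_single_orbit_iff_isomorphic:
  assumes "finite S" "f \<in> S \<rightarrow> S" "card S = n"
  shows "nearly_single_orbit f S \<longleftrightarrow>
    (\<exists>m. 1 \<le> m \<and> m \<le> n \<and> isomorphic (functional_graph S f) (U m (n - m))) \<or>
    (\<exists>m. 2 \<le> m \<and> m \<le> n - 1 \<and>
      isomorphic (functional_graph S f) (disjoint_union Z1 (U m (n - 1 - m))))"
proof -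
  have one: "(\<exists>v. S = forward_orbit f v) \<longleftrightarrow>
      (\<exists>m. 1 \<le> m \<and> m \<le> n \<and> isomorphic (functional_graph S f) (U m (n - m)))"
    unfolding U_functional_graph isomorphic_functional_graph_iff[OF assms(2)]
    by (rule single_orbit_iff_conjugate_tailed_cycle[OF assms])
  have union: "isomorphic (functional_graph S f) (disjoint_union Z1 (U m t)) \<longleftrightarrow>
      (\<exists>p\<in>S. f p = p \<and> f \<in> (S - {p}) \<rightarrow> (S - {p}) \<and>
        conjugate (S - {p}) f {..<m + t} (tailed_cycle m))" if "1 \<le> m" for m t
    unfolding Z1_functional_graph U_functional_graph disjoint_union_functional_graph
      isomorphic_functional_graph_iff[OF assms(2)]
    by (rule conjugate_isolated_fixed_point_iff[OF assms(2) tailed_cycle_closed[OF that]])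
  have rest: "(\<exists>v. S - {p} = forward_orbit f v) \<and> (\<forall>x\<in>S - {p}. f x \<noteq> x) \<longleftrightarrow>
      f \<in> (S - {p}) \<rightarrow> (S - {p}) \<and> (\<exists>m. 2 \<le> m \<and> m \<le> n - 1 \<and>
        conjugate (S - {p}) f {..<m + (n - 1 - m)} (tailed_cycle m))" if p: "p \<in> S" for p
  proof (cases "f \<in> (S - {p}) \<rightarrow> (S - {p})")
    case False
    then show ?thesis using forward_orbit_closed[of f] by metis
  next
    case True
    have "m \<noteq> 1 \<longleftrightarrow> (\<forall>x\<in>S - {p}. f x \<noteq> x)"
      if "1 \<le> m" "conjugate (S - {p}) f {..<m + t} (tailed_cycle m)" for m t
      using conjugate_fixed_point_iff[OF True that(2)] tailed_cycle_fixed_point_iff[OF that(1)]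
      by blast
    moreover have "2 \<le> m \<longleftrightarrow> 1 \<le> m \<and> m \<noteq> 1" for m :: nat by linarith
    moreover have "card (S - {p}) = n - 1" using assms(1,3) p by simp
    ultimately show ?thesis
      using single_orbit_iff_conjugate_tailed_cycle[of "S - {p}" f "n - 1"] assms(1) True by auto
  qed
  have "(\<exists>p\<in>S. f p = p \<and> (\<exists>v. S - {p} = forward_orbit f v) \<and> (\<forall>x\<in>S - {p}. f x \<noteq> x)) \<longleftrightarrow>
      (\<exists>m. 2 \<le> m \<and> m \<le> n - 1 \<and>
        isomorphic (functional_graph S f) (disjoint_union Z1 (U m (n - 1 - m))))"
    (is "?L \<longleftrightarrow> ?R")
  proof -
    have "?L \<longleftrightarrow> (\<exists>p\<in>S. f p = p \<and> f \<in> (S - {p}) \<rightarrow> (S - {p}) \<and> (\<exists>m. 2 \<le> m \<and> m \<le> n - 1 \<and>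
        conjugate (S - {p}) f {..<m + (n - 1 - m)} (tailed_cycle m)))"
      by (rule bex_cong[OF refl]) (simp only: rest)
    also have "\<dots> \<longleftrightarrow> (\<exists>m. 2 \<le> m \<and> m \<le> n - 1 \<and> (\<exists>p\<in>S. f p = p \<and> f \<in> (S - {p}) \<rightarrow> (S - {p}) \<and>
        conjugate (S - {p}) f {..<m + (n - 1 - m)} (tailed_cycle m)))"
      by meson
    also have "\<dots> \<longleftrightarrow> ?R" 
      by (intro ex_cong1 conj_cong refl) (subst union, simp_all)
    finally show ?thesis .
  qed
  then show ?thesis unfolding nearly_single_orbit_def one by simp
qed

lemma ex_single_orbit:
  assumes "finite S" "S \<noteq> {}"
  shows "\<exists>f \<in> S \<rightarrow>\<^sub>E S. \<exists>v. S = forward_orbit f v"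
proof -
  define n where "n = card S"
  have n: "1 \<le> n" using assms by (simp add: n_def Suc_le_eq card_gt_0_iff)
  obtain e where e: "bij_betw e {..<n} S"
    using ex_bij_betw_nat_finite[OF assms(1)] by (auto simp: n_def atLeast0LessThan)
  define f where "f = (\<lambda>x\<in>S. e (tailed_cycle n (inv_into {..<n} e x)))"
  have cl: "tailed_cycle n i < n" if "i < n" for i
    using tailed_cycle_closed[OF n, of 0] that by auto
  have ix: "inv_into {..<n} e x < n" if "x \<in> S" for x
    using bij_betw_apply[OF bij_betw_inv_into[OF e] that] by simp
  have "f \<in> S \<rightarrow>\<^sub>E S"
    using cl ix bij_betw_apply[OF e] by (auto simp: f_def)
  moreover have "f (e i) = e (tailed_cycle n i)" if "i < n" for i
    using that bij_betw_apply[OF e, of i] bij_betw_inv_into_left[OF e, of i] by (simp add: f_def)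
  then have "conjugate {..<n} (tailed_cycle n) S f"
    unfolding conjugate_def using e by auto
  then have "\<exists>v. S = forward_orbit f v"
    using tailed_cycle_single_orbit[OF n, of 0] forward_orbit_closed conjugate_forward_orbit
    by (metis add.right_neutral)
  ultimately show ?thesis by blast
qed

theorem proposition2p35:
  fixes S :: "'a set" and n :: nat
  assumes "finite S" and "S \<noteq> {}" and "card S = n"
  shows "Min ((\<lambda>f. card (centralizer S f)) ` (S \<rightarrow>\<^sub>E S)) = n \<and>
    (\<forall>f \<in> S \<rightarrow>\<^sub>E S. card (centralizer S f) = n \<longleftrightarrow>
       (\<exists>m. 1 \<le> m \<and> m \<le> n \<and>
          isomorphic (functional_graph S f) (U m (n - m))) \<or>
       (\<exists>m. 2 \<le> m \<and> m \<le> n - 1 \<and>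
          isomorphic (functional_graph S f) (disjoint_union Z1 (U m (n - 1 - m)))))"
proof
  have closed: "f \<in> S \<rightarrow> S" if "f \<in> S \<rightarrow>\<^sub>E S" for f using that by (auto simp: PiE_def)
  have ge: "n \<le> card (centralizer S f)" if "f \<in> S \<rightarrow>\<^sub>E S" for f
    using card_equivariant_ge[OF assms(1) closed[OF that] assms(2)] assms(3)
    by (simp add: centralizer_eq_equivariant[OF closed[OF that]])
  have eq: "card (centralizer S f) = n \<longleftrightarrow> nearly_single_orbit f S" if "f \<in> S \<rightarrow>\<^sub>E S" for f
    using card_equivariant_eq_iff[OF assms(1) closed[OF that] assms(2)] assms(3)
    by (simp add: centralizer_eq_equivariant[OF closed[OF that]])
  show "Min ((\<lambda>f. card (centralizer S f)) ` (S \<rightarrow>\<^sub>E S)) = n"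
  proof (rule Min_eqI)
    show "finite ((\<lambda>f. card (centralizer S f)) ` (S \<rightarrow>\<^sub>E S))"
      using assms(1) by (intro finite_imageI finite_PiE) auto
    obtain f where f: "f \<in> S \<rightarrow>\<^sub>E S" "\<exists>v. S = forward_orbit f v"
      using ex_single_orbit[OF assms(1,2)] by blast
    then have "card (centralizer S f) = n" using eq unfolding nearly_single_orbit_def by blast
    then show "n \<in> (\<lambda>f. card (centralizer S f)) ` (S \<rightarrow>\<^sub>E S)" using f(1) by force
  qed (use ge in auto)
  show "\<forall>f \<in> S \<rightarrow>\<^sub>E S. card (centralizer S f) = n \<longleftrightarrow>
       (\<exists>m. 1 \<le> m \<and> m \<le> n \<and>
          isomorphic (functional_graph S f) (U m (n - m))) \<or>
       (\<exists>m. 2 \<le> m \<and> m \<le> n - 1 \<and>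
          isomorphic (functional_graph S f) (disjoint_union Z1 (U m (n - 1 - m))))"
    using eq nearly_single_orbit_iff_isomorphic[OF assms(1) closed assms(3)] by simp
qed

end
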